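(* Let $Q_3(p_1,p_2)=p_1(p_1+p_2)$. Then $Q_3$ is a maximal element of $\mathtt{A}_3$, i.e. $Q_3\in\mathtt{A}_3$ and whenever $\tilde P\in\mathtt{A}_3$ satisfies $\tilde P\ge Q_3$ on $A_3$ one has $\tilde P=Q_3$. Moreover, $Q_3$ is the largest element of $\hat{\mathtt{A}}_3$, i.e. $Q_3\in\hat{\mathtt{A}}_3$ and $P\le Q_3$ on $A_3$ for all $P\in\hat{\mathtt{A}}_3$.
   Context: Let $A_3=\{(p_1,p_2)\in\mathbb{R}^2: p_1,p_2\ge0,\ p_1+p_2\le1\}$. For $(p_1,p_2)\in A_3$ put $p_3=1-p_1-p_2$, let $(X_i)_{i\ge1}$ be i.i.d. with $\mathbb{P}(X_1=l)=p_l$ for $1\le l\le3$, let $S_0=0$, $S_n=\sum_{i=1}^nX_i$, and let $u_n=\mathbb{P}(n\in\{S_0,S_1,\dots\})$ be the renewal masses. Thus $u_0=1$ and $u_n=\sum_{l=1}^{\min\{n,3\}}p_lu_{n-l}$ for $n\ge1$. Let $m_3=m_3(p_1,p_2)=\min_{l\ge1}u_l$, a function on $A_3$. With $\deg$ denoting total degree, let $\mathtt{A}_3$ be the set of real polynomials $P$ in two variables with $\deg(P)\le2$ and $P\le m_3$ on $A_3$. For $P\in\mathtt{A}_3$ set $\hat P(p_1,p_2)=P(p_1,p_2-p_1)$, $\hat P_1(p_1)=\hat P(p_1,1)$ and $\hat P_2(p_1,p_2)=\hat P(p_1,p_2)$. Define $$\hat{\mathtt{A}}_3=\{P\in\mathtt{A}_3:\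 \deg(\hat P_j)\le j\ \text{ for } j=1,2\}.$$ *)

theory Defs
  imports "HOL-Probability.Probability" "HOL-Computational_Algebra.Polynomial"
begin

section \<open>Renewal masses for steps in \<open>{1, 2, 3}\<close>\<close>

definition A3 :: "(real \<times> real) set" where
  "A3 = {(p1, p2). 0 \<le> p1 \<and> 0 \<le> p2 \<and> p1 + p2 \<le> 1}"

text \<open>Only meaningful for parameters in \<^const>\<open>A3\<close>, as are all notions below that depend on it.\<close>

definition step_pmf :: "real \<times> real \<Rightarrow> nat pmf" where
  "step_pmf = (\<lambda>(p1, p2). pmf_of_list [(1, p1), (2, p2), (3, 1 - p1 - p2)])"

text \<open>The i.i.d. steps are the coordinates of the infinite product space; \<open>\<omega> i\<close> is the
  step with number \<open>i + 1\<close>, and \<open>\<Sum>i<k. \<omega> i\<close> is the partial sum \<open>S\<^sub>k\<close>.\<close>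

definition renewal_mass :: "real \<times> real \<Rightarrow> nat \<Rightarrow> real" where
  "renewal_mass p n =
     measure (\<Pi>\<^sub>M i\<in>(UNIV :: nat set). measure_pmf (step_pmf p)) {\<omega>. \<exists>k. (\<Sum>i<k. \<omega> i) = n}"

text \<open>The infimum is a minimum: see \<open>m3_attained\<close> below.\<close>

definition m3 :: "real \<times> real \<Rightarrow> real" where
  "m3 p = (INF l\<in>{1..}. renewal_mass p l)"

lemma step_pmf_wf:
  assumes "(p1, p2) \<in> A3"
  shows "pmf_of_list_wf [(1 :: nat, p1), (2, p2), (3, 1 - p1 - p2)]"
  using assms by (auto simp: pmf_of_list_wf_def A3_def)

lemma pmf_step_pmf:
  assumes "(p1, p2) \<in> A3"
  shows "pmf (step_pmf (p1, p2)) l =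
    (if l = 1 then p1 else if l = 2 then p2 else if l = 3 then 1 - p1 - p2 else 0)"
  using step_pmf_wf[OF assms] by (auto simp: step_pmf_def pmf_pmf_of_list)

lemma set_step_pmf:
  assumes "p \<in> A3"
  shows "set_pmf (step_pmf p) \<subseteq> {1, 2, 3}"
  using assms by (cases p) (auto simp: set_pmf_eq pmf_step_pmf split: if_splits)

lemma renewal_mass_0: "renewal_mass p 0 = 1"
proof -
  interpret prob_space "\<Pi>\<^sub>M i\<in>(UNIV :: nat set). measure_pmf (step_pmf p)"
    by (intro prob_space_PiM measure_pmf.prob_space_axioms)
  have *: "{\<omega> :: nat \<Rightarrow> nat. \<exists>k. (\<Sum>i<k. \<omega> i) = (0 :: nat)} = UNIV"
    by (auto intro!: exI[of _ "0 :: nat"])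
  have "prob UNIV = 1"
    using prob_space by (simp add: space_PiM PiE_UNIV_domain)
  then show ?thesis
    by (simp only: renewal_mass_def *)
qed

lemma renewal_mass_rec:
  assumes p: "p \<in> A3" and n: "n \<ge> 1"
  shows "renewal_mass p n = (\<Sum>l=1..min n 3. pmf (step_pmf p) l * renewal_mass p (n - l))"
proof -
  let ?M = "measure_pmf (step_pmf p)"
  interpret sequence_space ?M
    by unfold_locales
  define E where "E n = {\<omega> :: nat \<Rightarrow> nat. \<exists>k. (\<Sum>i<k. \<omega> i) = n}" for n
  have E_sets [measurable]: "E m \<in> sets S" for m
  proof -
    have "{\<omega> \<in> space S. \<exists>k. (\<Sum>i<k. \<omega> i) = m} \<in> sets S"
      by measurable
    then show ?thesis
      by (simp add: E_def space_PiM PiE_UNIV_domain)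
  qed
  have shift: "case_nat s \<omega> \<in> E n \<longleftrightarrow> s \<le> n \<and> \<omega> \<in> E (n - s)" for s \<omega>
  proof
    assume "case_nat s \<omega> \<in> E n"
    then obtain k where k: "(\<Sum>i<k. case_nat s \<omega> i) = n"
      by (auto simp: E_def)
    with n obtain k' where "k = Suc k'"
      by (cases k) auto
    with k have "s + (\<Sum>i<k'. \<omega> i) = n"
      by (simp add: sum.lessThan_Suc_shift del: sum.lessThan_Suc)
    then show "s \<le> n \<and> \<omega> \<in> E (n - s)"
      by (auto simp: E_def)
  next
    assume *: "s \<le> n \<and> \<omega> \<in> E (n - s)"
    then obtain k where "(\<Sum>i<k. \<omega> i) = n - s"
      by (auto simp: E_def)
    with * have "(\<Sum>i<Suc k. case_nat s \<omega> i) = n"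
      by (simp add: sum.lessThan_Suc_shift del: sum.lessThan_Suc)
    then show "case_nat s \<omega> \<in> E n"
      unfolding E_def by blast
  qed
  have mass: "emeasure S (E m) = ennreal (renewal_mass p m)" for m
    by (simp add: renewal_mass_def E_def P.emeasure_eq_measure)
  have meas: "(\<lambda>(s, \<omega>). case_nat s \<omega>) \<in> measurable (?M \<Otimes>\<^sub>M S) S"
    by measurable
  have "emeasure S (E n) = emeasure (distr (?M \<Otimes>\<^sub>M S) S (\<lambda>(s, \<omega>). case_nat s \<omega>)) (E n)"
    by (simp add: PiM_iter)
  also have "\<dots> = emeasure (?M \<Otimes>\<^sub>M S)
      ((\<lambda>(s, \<omega>). case_nat s \<omega>) -` E n \<inter> space (?M \<Otimes>\<^sub>M S))"
    by (rule emeasure_distr[OF meas E_sets])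
  also have "\<dots> = (\<integral>\<^sup>+ s. emeasure S (Pair s -`
      ((\<lambda>(s, \<omega>). case_nat s \<omega>) -` E n \<inter> space (?M \<Otimes>\<^sub>M S))) \<partial>?M)"
    by (rule P.emeasure_pair_measure_alt) (rule measurable_sets[OF meas E_sets])
  also have "\<dots> = (\<integral>\<^sup>+ s. (if s \<le> n then ennreal (renewal_mass p (n - s)) else 0) \<partial>?M)"
  proof (rule nn_integral_cong)
    fix s
    have "Pair s -` ((\<lambda>(s, \<omega>). case_nat s \<omega>) -` E n \<inter> space (?M \<Otimes>\<^sub>M S)) =
        (if s \<le> n then E (n - s) else {})"
      by (auto simp: shift space_pair_measure space_PiM PiE_UNIV_domain)
    then show "emeasure S (Pair s -`
        ((\<lambda>(s, \<omega>). case_nat s \<omega>) -` E n \<inter> space (?M \<Otimes>\<^sub>M S))) =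
        (if s \<le> n then ennreal (renewal_mass p (n - s)) else 0)"
      by (simp add: mass)
  qed
  also have "\<dots> = (\<Sum>s\<in>{1,2,3}. (if s \<le> n then ennreal (renewal_mass p (n - s)) else 0)
      * ennreal (pmf (step_pmf p) s))"
    by (rule nn_integral_measure_pmf_support) (use set_step_pmf[OF p] in \<open>auto simp: set_pmf_eq\<close>)
  also have "\<dots> = (\<Sum>s\<in>{1,2,3}. ennreal (if s \<le> n then renewal_mass p (n - s) * pmf (step_pmf p) s else 0))"
    by (intro sum.cong) (auto simp: ennreal_mult renewal_mass_def)
  also have "\<dots> = ennreal (\<Sum>s\<in>{1,2,3}. if s \<le> n then renewal_mass p (n - s) * pmf (step_pmf p) s else 0)"
    by (intro sum_ennreal) (auto simp: renewal_mass_def)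
  also have "(\<Sum>s\<in>{1,2,3}. if s \<le> n then renewal_mass p (n - s) * pmf (step_pmf p) s else 0)
      = (\<Sum>l=1..min n 3. pmf (step_pmf p) l * renewal_mass p (n - l))"
  proof -
    have "{s \<in> {1,2,3}. s \<le> n} = {1..min n 3}"
      by auto
    then show ?thesis
      by (simp only: sum.inter_filter[symmetric] finite.intros mult.commute)
  qed
  finally have "ennreal (renewal_mass p n) =
      ennreal (\<Sum>l=1..min n 3. pmf (step_pmf p) l * renewal_mass p (n - l))"
    by (simp add: mass)
  then show ?thesis
    by (subst (asm) ennreal_inj) (auto intro!: sum_nonneg simp: renewal_mass_def)
qed

lemma renewal_mass_ge_Min:
  assumes p: "p \<in> A3" and n: "n \<ge> 1"
  shows "Min (renewal_mass p ` {1,2,3}) \<le> renewal_mass p n" (is "?m \<le> _")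
  using n
proof (induction n rule: less_induct)
  case (less n)
  show ?case
  proof (cases "n \<le> 3")
    case True
    then have "n \<in> {1,2,3}"
      using less.prems by auto
    then show ?thesis
      by (intro Min_le) auto
  next
    case False
    obtain p1 p2 where p12: "p = (p1, p2)"
      by (cases p)
    have "?m = (\<Sum>l=1..3. pmf (step_pmf p) l * ?m)"
      using p by (simp add: p12 pmf_step_pmf numeral_3_eq_3 algebra_simps)
    also have "\<dots> \<le> (\<Sum>l=1..3. pmf (step_pmf p) l * renewal_mass p (n - l))"
      using False by (intro sum_mono mult_left_mono less.IH) auto
    also have "\<dots> = renewal_mass p n"
      using False less.prems by (simp add: renewal_mass_rec[OF p])
    finally show ?thesis .
  qed
qed

lemma m3_attained:
  assumes "p \<in> A3"
  shows "\<exists>l\<ge>1. m3 p = renewal_mass p l \<and> (\<forall>k\<ge>1. renewal_mass p l \<le> renewal_mass p k)"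
proof -
  have "Min (renewal_mass p ` {1,2,3}) \<in> renewal_mass p ` {1,2,3}"
    by (intro Min_in) auto
  then obtain l where l: "l \<in> {1,2,3}" "Min (renewal_mass p ` {1,2,3}) = renewal_mass p l"
    by (auto simp only: image_iff)
  have le: "\<forall>k\<ge>1. renewal_mass p l \<le> renewal_mass p k"
    using renewal_mass_ge_Min[OF assms] unfolding l by blast
  moreover have "l \<ge> 1"
    using l by auto
  moreover from this le have "m3 p = renewal_mass p l"
    unfolding m3_def by (intro cInf_eq_minimum) auto
  ultimately show ?thesis
    by blast
qed

section \<open>Polynomials in two variables\<close>

text \<open>A polynomial in \<open>p\<^sub>1, p\<^sub>2\<close> is a \<^typ>\<open>real poly poly\<close>: the outer variable is \<open>p\<^sub>2\<close>,
  the inner one is \<open>p\<^sub>1\<close>, so that \<open>coeff (coeff P j) i\<close> belongs to \<open>p\<^sub>1\<^sup>i p\<^sub>2\<^sup>j\<close>.\<close>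

definition eval2 :: "real poly poly \<Rightarrow> real \<times> real \<Rightarrow> real" where
  "eval2 P = (\<lambda>(p1, p2). poly (poly P [:p2:]) p1)"

definition var1 :: "real poly poly" where
  "var1 = [:[:0, 1:]:]"

definition var2 :: "real poly poly" where
  "var2 = [:0, 1:]"

text \<open>As for \<^const>\<open>degree\<close>, the zero polynomial gets total degree \<open>0\<close>.\<close>

definition total_degree :: "real poly poly \<Rightarrow> nat" where
  "total_degree P = Sup {i + j | i j. coeff (coeff P j) i \<noteq> 0}"

lemma eval2_simps:
  "eval2 var1 (p1, p2) = p1"
  "eval2 var2 (p1, p2) = p2"
  "eval2 [:[:c:]:] (p1, p2) = c"
  "eval2 (P + Q) (p1, p2) = eval2 P (p1, p2) + eval2 Q (p1, p2)"
  "eval2 (P - Q) (p1, p2) = eval2 P (p1, p2) - eval2 Q (p1, p2)"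
  "eval2 (P * Q) (p1, p2) = eval2 P (p1, p2) * eval2 Q (p1, p2)"
  by (simp_all add: eval2_def var1_def var2_def)

lemma total_degree_le_iff:
  "total_degree P \<le> d \<longleftrightarrow> (\<forall>i j. coeff (coeff P j) i \<noteq> 0 \<longrightarrow> i + j \<le> d)"
proof -
  let ?X = "{i + j | i j. coeff (coeff P j) i \<noteq> 0}"
  have "?X \<subseteq> (\<Union>j\<le>degree P. \<Union>i\<le>degree (coeff P j). {i + j})"
    by (fastforce intro: le_degree)
  then have "finite ?X"
    by (rule finite_subset) auto
  then show ?thesis
    by (cases "?X = {}") (auto simp: total_degree_def cSup_eq_Max)
qed

definition minorants3 :: "real poly poly set" where
  "minorants3 = {P. total_degree P \<le> 2 \<and> (\<forall>p\<in>A3. eval2 P p \<le> m3 p)}"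

text \<open>The substitution \<open>p\<^sub>2 := p\<^sub>2 - p\<^sub>1\<close>; evaluating the outer variable at \<open>1\<close> then gives the
  univariate polynomial \<open>p\<^sub>1 \<mapsto> P(p\<^sub>1, 1 - p\<^sub>1)\<close>.\<close>

definition hat :: "real poly poly \<Rightarrow> real poly poly" where
  "hat P = pcompose P (var2 - var1)"

definition hat1 :: "real poly poly \<Rightarrow> real poly" where
  "hat1 P = poly (hat P) 1"

definition hat2 :: "real poly poly \<Rightarrow> real poly poly" where
  "hat2 P = hat P"

lemma eval2_hat: "eval2 (hat P) (p1, p2) = eval2 P (p1, p2 - p1)"
proof -
  have "poly (poly P q) x = poly (poly P [:poly q x:]) x" for q and x :: real
    by (induction P) auto
  from this[of "[:p2, -1:]" p1] show ?thesis
    by (simp add: eval2_def hat_def poly_pcompose var1_def var2_def)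
qed

lemma poly_hat1: "poly (hat1 P) p1 = eval2 (hat P) (p1, 1)"
  by (simp add: hat1_def eval2_def one_pCons)

definition hat_minorants3 :: "real poly poly set" where
  "hat_minorants3 = {P \<in> minorants3. degree (hat1 P) \<le> 1 \<and> total_degree (hat2 P) \<le> 2}"

definition Q3 :: "real poly poly" where
  "Q3 = var1 * (var1 + var2)"

end

theory Submission
  imports Defs
begin

text \<open>
  Write \<open>x = p\<^sub>1\<close>, \<open>y = p\<^sub>2\<close>. By the recursion the minimum \<open>m\<^sub>3\<close> is attained among
  \<open>u\<^sub>1 = x\<close>, \<open>u\<^sub>2 = y + x\<^sup>2\<close> and \<open>u\<^sub>3 = 1 - x - y + 2xy + x\<^sup>3\<close>, and
  \<open>u\<^sub>1 - Q\<^sub>3 = x (1 - x - y)\<close>, \<open>u\<^sub>2 - Q\<^sub>3 = y (1 - x)\<close>,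
  \<open>u\<^sub>3 - Q\<^sub>3 = (1 - x) (1 - y - x\<^sup>2)\<close>
  are nonnegative on the triangle. The first two differences show moreover that \<open>Q\<^sub>3 = m\<^sub>3\<close> on the
  whole boundary: \<open>u\<^sub>1 = Q\<^sub>3\<close> on the edges \<open>x = 0\<close> and \<open>x + y = 1\<close>, and \<open>u\<^sub>2 = Q\<^sub>3\<close> on the
  edge \<open>y = 0\<close>. Both claims follow from this contact on the boundary.

  If \<open>Q\<^sub>3 \<le> P \<le> m\<^sub>3\<close>, then \<open>P\<close> and \<open>Q\<^sub>3\<close> agree on the boundary. A quadratic polynomial is
  determined by its values at the three vertices and the three midpoints of the edges, hence
  \<open>P = Q\<^sub>3\<close>.

  If \<open>P\<close> is a quadratic minorant such that \<open>x \<mapsto> P(x, 1 - x)\<close> has degree at most one, then the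
  quadratic part of \<open>P\<close> vanishes in the direction \<open>(1, -1)\<close>, so \<open>P\<close> is affine on every segment
  \<open>x + y = s\<close>. There \<open>Q\<^sub>3 = s x\<close> is affine too, and \<open>P \<le> m\<^sub>3 = Q\<^sub>3\<close> at the two ends of the segment,
  which lie on the boundary; hence \<open>P \<le> Q\<^sub>3\<close> on the segment.
\<close>

lemma mem_A3_iff: "(x, y) \<in> A3 \<longleftrightarrow> 0 \<le> x \<and> 0 \<le> y \<and> x + y \<le> 1"
  by (simp add: A3_def)

lemma renewal_mass_1:
  assumes "(x, y) \<in> A3"
  shows "renewal_mass (x, y) (Suc 0) = x"
  using renewal_mass_rec[OF assms, of 1] by (simp add: pmf_step_pmf[OF assms] renewal_mass_0)

lemma renewal_mass_2:
  assumes "(x, y) \<in> A3"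
  shows "renewal_mass (x, y) 2 = y + x\<^sup>2"
  using renewal_mass_rec[OF assms, of 2]
  by (simp add: pmf_step_pmf[OF assms] renewal_mass_0 renewal_mass_1[OF assms]
      numeral_2_eq_2 power2_eq_square)

lemma renewal_mass_3:
  assumes "(x, y) \<in> A3"
  shows "renewal_mass (x, y) 3 = 1 - x - y + 2 * x * y + x ^ 3"
proof -
  have "{1..min 3 3} = {1, 2, 3 :: nat}"
    by auto
  then show ?thesis
    using renewal_mass_rec[OF assms, of 3] renewal_mass_2[OF assms]
    by (simp add: pmf_step_pmf[OF assms] renewal_mass_0 renewal_mass_1[OF assms]
        power2_eq_square power3_eq_cube algebra_simps)
qed

lemma m3_le_renewal_mass:
  assumes "l \<ge> 1"
  shows "m3 p \<le> renewal_mass p l"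
  unfolding m3_def
proof (rule cINF_lower)
  show "bdd_below (renewal_mass p ` {1..})"
    by (rule bdd_belowI2[where m = 0]) (simp add: renewal_mass_def)
qed (use assms in simp)

lemma eval2_Q3: "eval2 Q3 (x, y) = x * (x + y)"
  by (simp add: Q3_def eval2_simps)

lemma Q3_le_m3:
  assumes "p \<in> A3"
  shows "eval2 Q3 p \<le> m3 p"
proof -
  obtain x y where p: "p = (x, y)"
    by (cases p)
  with assms have A: "(x, y) \<in> A3" and xy: "0 \<le> x" "0 \<le> y" "x + y \<le> 1"
    by (auto simp: mem_A3_iff)
  have "0 \<le> x * (1 - x - y)"
    using xy by simp
  then have 1: "x * (x + y) \<le> x"
    by (simp add: algebra_simps)
  have "0 \<le> y * (1 - x)"
    using xy by simp
  then have 2: "x * (x + y) \<le> y + x\<^sup>2"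
    by (simp add: algebra_simps power2_eq_square)
  have "x\<^sup>2 \<le> x"
    using xy by (simp add: power2_eq_square mult_left_le)
  then have "0 \<le> (1 - x) * (1 - y - x\<^sup>2)"
    using xy by simp
  then have 3: "x * (x + y) \<le> 1 - x - y + 2 * x * y + x ^ 3"
    by (simp add: algebra_simps power2_eq_square power3_eq_cube)
  have "eval2 Q3 p \<le> Min (renewal_mass p ` {1, 2, 3})"
    using 1 2 3
    by (simp add: p eval2_Q3 renewal_mass_1[OF A] renewal_mass_2[OF A] renewal_mass_3[OF A])
  also have "\<dots> \<le> m3 p"
    unfolding m3_def using renewal_mass_ge_Min[OF assms] by (intro cINF_greatest) auto
  finally show ?thesis .
qed

text \<open>On two edges \<open>Q\<^sub>3\<close> coincides with \<open>u\<^sub>1\<close>, on the third one with \<open>u\<^sub>2\<close>.\<close>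

lemma m3_le_Q3_on_boundary:
  assumes A: "(x, y) \<in> A3" and edge: "x = 0 \<or> y = 0 \<or> x + y = 1"
  shows "m3 (x, y) \<le> eval2 Q3 (x, y)"
  using m3_le_renewal_mass[of 1 "(x, y)"] m3_le_renewal_mass[of 2 "(x, y)"] edge
  by (auto simp: eval2_Q3 renewal_mass_1[OF A] renewal_mass_2[OF A] power2_eq_square)

lemma total_degree_le_2E:
  assumes "total_degree P \<le> 2"
  obtains a b c d e f where "P = [:[:a, b, d:], [:c, e:], [:f:]:]"
proof
  have zero: "coeff (coeff P j) i = 0" if "i + j > 2" for i j
    using assms that unfolding total_degree_le_iff by (meson not_less)
  let ?c = "\<lambda>i j. coeff (coeff P j) i"
  show "P = [:[:?c 0 0, ?c 1 0, ?c 2 0:], [:?c 0 1, ?c 1 1:], [:?c 0 2:]:]"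
    by (intro poly_eqI)
      (auto simp: coeff_pCons numeral_2_eq_2 zero split: nat.split)
qed

lemma total_degree_quadratic: "total_degree [:[:a, b, d:], [:c, e:], [:f:]:] \<le> 2"
  unfolding total_degree_le_iff by (auto simp: coeff_pCons split: nat.splits)

lemma eval2_quadratic:
  "eval2 [:[:a, b, d:], [:c, e:], [:f:]:] (x, y) =
    a + b * x + c * y + d * x\<^sup>2 + e * x * y + f * y\<^sup>2"
  by (simp add: eval2_def algebra_simps power2_eq_square)

lemma Q3_eq: "Q3 = [:[:0, 0, 1:], [:0, 1:], [:0:]:]"
  by (simp add: Q3_def var1_def var2_def)

text \<open>The vertices and the midpoints of the edges are unisolvent nodes for quadratic interpolation
  on a triangle.\<close>

lemma quadratic_eqI_on_boundary:
  assumes P: "total_degree P \<le> 2" and Q: "total_degree Q \<le> 2"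
    and eq: "\<And>x y. (x, y) \<in> A3 \<Longrightarrow> x = 0 \<or> y = 0 \<or> x + y = 1 \<Longrightarrow>
      eval2 P (x, y) = eval2 Q (x, y)"
  shows "P = Q"
proof -
  obtain a b c d e f where P_eq: "P = [:[:a, b, d:], [:c, e:], [:f:]:]"
    using total_degree_le_2E[OF P] .
  obtain a' b' c' d' e' f' where Q_eq: "Q = [:[:a', b', d':], [:c', e':], [:f':]:]"
    using total_degree_le_2E[OF Q] .
  have "eval2 P (x, y) = eval2 Q (x, y)"
    if "(x, y) \<in> {(0, 0), (1, 0), (0, 1), (1/2, 0), (0, 1/2), (1/2, 1/2)}" for x y
    using that by (intro eq) (auto simp: mem_A3_iff)
  note nodes = this[unfolded P_eq Q_eq eval2_quadratic]
  have "a = a'"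
    using nodes[of 0 0] by simp
  moreover from this have "b = b'" "d = d'"
    using nodes[of 1 0] nodes[of "1/2" 0] by (simp_all add: power2_eq_square)
  moreover have "c = c'" "f = f'"
    using \<open>a = a'\<close> nodes[of 0 1] nodes[of 0 "1/2"] by (simp_all add: power2_eq_square)
  ultimately have "e = e'"
    using nodes[of "1/2" "1/2"] by (simp add: power2_eq_square)
  with \<open>a = a'\<close> \<open>b = b'\<close> \<open>d = d'\<close> \<open>c = c'\<close> \<open>f = f'\<close> show ?thesis
    by (simp add: P_eq Q_eq)
qed

lemma Q3_minorant: "Q3 \<in> minorants3"
  using Q3_le_m3 total_degree_quadratic[of 0 0 1 0 1 0]
  by (simp add: minorants3_def Q3_eq)

lemma Q3_maximal:
  assumes P: "P \<in> minorants3" and ge: "\<And>p. p \<in> A3 \<Longrightarrow> eval2 Q3 p \<le> eval2 P p"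
  shows "P = Q3"
proof (rule quadratic_eqI_on_boundary)
  fix x y
  assume A: "(x, y) \<in> A3" and "x = 0 \<or> y = 0 \<or> x + y = 1"
  then have "m3 (x, y) \<le> eval2 Q3 (x, y)"
    by (rule m3_le_Q3_on_boundary)
  moreover have "eval2 P (x, y) \<le> m3 (x, y)"
    using P A by (simp add: minorants3_def)
  ultimately show "eval2 P (x, y) = eval2 Q3 (x, y)"
    using ge[OF A] by simp
qed (use P Q3_minorant in \<open>simp_all add: minorants3_def\<close>)

lemma Q3_hat_minorant: "Q3 \<in> hat_minorants3"
proof -
  have hat_eq: "hat Q3 = [:[:0, 0, 0:], [:0, 1:], [:0:]:]"
    by (simp add: hat_def Q3_eq var1_def var2_def pcompose_pCons)
  have "degree (hat1 Q3) \<le> 1"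
    by (simp add: hat1_def hat_eq)
  moreover have "total_degree (hat2 Q3) \<le> 2"
    unfolding hat2_def hat_eq by (rule total_degree_quadratic)
  ultimately show ?thesis
    using Q3_minorant by (simp add: hat_minorants3_def)
qed

text \<open>On the line \<open>x + y = s\<close> the coefficient of \<open>x\<^sup>2\<close> is \<open>d - e + f\<close>, whatever \<open>s\<close> is. It vanishes
  because it does so for \<open>s = 1\<close>, and the interpolation formula is that of an affine function of
  \<open>x\<close> with nodes \<open>0\<close> and \<open>s\<close>, multiplied by \<open>s\<close> to include \<open>s = 0\<close>.\<close>

lemma hat1_linear_imp_affine_on_diagonals:
  assumes P: "total_degree P \<le> 2" and lin: "degree (hat1 P) \<le> 1"
  shows "(x + y) * eval2 P (x, y) = y * eval2 P (0, x + y) + x * eval2 P (x + y, 0)"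
proof -
  obtain a b c d e f where P_eq: "P = [:[:a, b, d:], [:c, e:], [:f:]:]"
    using total_degree_le_2E[OF P] .
  have "hat1 P = [:a + c + f, b - c + e - 2 * f, d - e + f:]"
    by (rule iffD1[OF poly_eq_poly_eq_iff], rule ext)
      (simp add: poly_hat1 eval2_hat P_eq eval2_quadratic algebra_simps power2_eq_square)
  then have "e = d + f"
    using lin by (auto split: if_splits)
  then show ?thesis
    by (simp add: P_eq eval2_quadratic algebra_simps power2_eq_square)
qed

lemma hat_minorant_le_Q3:
  assumes P: "P \<in> hat_minorants3" and A: "p \<in> A3"
  shows "eval2 P p \<le> eval2 Q3 p"
proof -
  obtain x y where p: "p = (x, y)"
    by (cases p)
  with A have xy: "0 \<le> x" "0 \<le> y" "x + y \<le> 1"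
    by (auto simp: mem_A3_iff)
  have le_boundary: "eval2 P (x', y') \<le> eval2 Q3 (x', y')"
    if "(x', y') \<in> A3" "x' = 0 \<or> y' = 0" for x' y'
  proof -
    have "eval2 P (x', y') \<le> m3 (x', y')"
      using P that by (simp add: hat_minorants3_def minorants3_def)
    also have "\<dots> \<le> eval2 Q3 (x', y')"
      using that by (intro m3_le_Q3_on_boundary) auto
    finally show ?thesis .
  qed
  have ends: "(0, x + y) \<in> A3" "(x + y, 0) \<in> A3"
    using xy by (auto simp: mem_A3_iff)
  show ?thesis
  proof (cases "x + y = 0")
    case True
    then show ?thesis
      using le_boundary[of x y] A xy by (simp add: p)
  next
    case False
    have affine: "(x + y) * eval2 R (x, y) = y * eval2 R (0, x + y) + x * eval2 R (x + y, 0)"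
      if "R \<in> hat_minorants3" for R
      using that by (intro hat1_linear_imp_affine_on_diagonals)
        (simp_all add: hat_minorants3_def minorants3_def)
    have "(x + y) * eval2 P (x, y) \<le> (x + y) * eval2 Q3 (x, y)"
      unfolding affine[OF P] affine[OF Q3_hat_minorant]
      using xy ends le_boundary by (intro add_mono mult_left_mono) auto
    then show ?thesis
      using False xy by (simp add: p mult_le_cancel_left)
  qed
qed

theorem proposition3p8:
  shows "(Q3 \<in> minorants3 \<and>
          (\<forall>P\<in>minorants3. (\<forall>p\<in>A3. eval2 Q3 p \<le> eval2 P p) \<longrightarrow> P = Q3)) \<and>
         (Q3 \<in> hat_minorants3 \<and>
          (\<forall>P\<in>hat_minorants3. \<forall>p\<in>A3. eval2 P p \<le> eval2 Q3 p))"
  using Q3_minorant Q3_maximal Q3_hat_minorant hat_minorant_le_Q3 by blast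

end
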